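(* Let $n\geqslant1$. For every $T\in\operatorname{SYT}(n)$, $\#\phi^{-1}(T)=\prod_{i=1}^n\sigma_i(T)$. Consequently, for every smooth function $c=c(x)$, with $D=\frac{\mathrm{d}}{\mathrm{d}x}$ and $c_k=D^kc$, $$(cD)^nc=\sum_{T\in\operatorname{SYT}(n)}\#\phi^{-1}(T)\,w(T)=\sum_{T\in\operatorname{SYT}(n)}\left(\prod_{i=1}^n\sigma_i(T)c_i^{w_i(T)}\right)c^{n+1-\ell(\lambda(T))}.$$
   Context: $(cD)^nc$ means applying $n$ times $g\mapsto c\,Dg$ to $c$. $\operatorname{SYT}(n)$ is the set of standard Young tableaux with $n$ boxes (French convention: rows left-justified, weakly decreasing lengths from bottom to top, entries $1,\ldots,n$ each once, increasing along rows left to right and along columns bottom to top). For $T\in\operatorname{SYT}(n)$: $\ell(\lambda(T))$ is its number of rows, $w_i(T)$ the number of rows with exactly $i$ boxes, and $w(T)=c^{n+1-\ell(\lambda(T))}\prod_{i=1}^nc_i^{w_i(T)}$. For $1\leqslant i\leqslant n$, $T_i$ is the tableau obtained by deleting the entries $i+1,\ldots,n$, and $\operatorname{col}_k(T_i)$ is the size of the $k$-th column of $T_i$. Define $\sigma_i(T)=i-\operatorname{col}_1(T_i)+1$ if $i$ lies in the first column of $T$, and $\sigma_i(T)=\operatorname{col}_k(T_i)-\operatorname{col}_{k+1}(T_i)+1$ if $i$ lies in the $(k+1)$-th column, $k\geqslant1$. $\operatorname{OWP}_n$ is the set of ordered weak set partitions $p=(B_0,\ldots,B_n)$ of $[n]$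 into $n+1$ pairwise disjoint possibly empty blocks with $1\in B_0$ and $\min B_i>i$ whenever $B_i\neq\emptyset$ ($1\leqslant i\leqslant n$). The map $\phi:\operatorname{OWP}_n\to\operatorname{SYT}(n)$: represent $p$ as an array whose $(i+1)$-th row from the bottom lists the elements of $B_i$ in increasing order, left-justified; delete empty rows, reorder the rows by length in decreasing order from bottom to top, then rearrange the entries of each column in increasing order from bottom to top. $\phi^{-1}(T)=\{p\in\operatorname{OWP}_n:\phi(p)=T\}$. *)

theory Defs
  imports "HOL-Analysis.Analysis"
begin

text \<open>
  A tableau is the list of its rows, from bottom to top (French convention), each row being
  the list of its entries from left to right. The outer list contains no empty row, so every
  tableau has exactly one representation.
\<close>

type_synonym tableau = "nat list list"

text \<open>Rows have 0-based list positions, but columns are numbered from 1. A column is read from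
  bottom to top.\<close>

definition column :: "nat \<Rightarrow> tableau \<Rightarrow> nat list" where
  "column k T = map (\<lambda>r. r ! (k - 1)) (filter (\<lambda>r. k \<le> length r) T)"

definition col :: "nat \<Rightarrow> tableau \<Rightarrow> nat" where
  "col k T = length (column k T)"

definition SYT :: "nat \<Rightarrow> tableau set" where
  "SYT n = {T.
     [] \<notin> set T \<and>
     sorted_wrt (\<ge>) (map length T) \<and>
     distinct (concat T) \<and> set (concat T) = {1..n} \<and>
     (\<forall>r\<in>set T. sorted_wrt (<) r) \<and>
     (\<forall>k\<ge>1. sorted_wrt (<) (column k T))}"

definition num_rows :: "tableau \<Rightarrow> nat" where
  "num_rows T = length T"

definition w_rows :: "nat \<Rightarrow> tableau \<Rightarrow> nat" where
  "w_rows i T = length (filter (\<lambda>r. length r = i) T)"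

text \<open>The tableau \<open>T\<^sub>i\<close>: rows that become empty are dropped.\<close>

definition subtableau :: "tableau \<Rightarrow> nat \<Rightarrow> tableau" where
  "subtableau T i = filter (\<lambda>r. r \<noteq> []) (map (filter (\<lambda>a. a \<le> i)) T)"

text \<open>For \<open>T \<in> SYT n\<close> and \<open>1 \<le> i \<le> n\<close> the entry \<open>i\<close> lies in exactly one column, so the
  description below denotes, and no subtraction of natural numbers truncates, since
  \<open>col 1 T\<^sub>i \<le> i\<close> and column sizes decrease weakly.\<close>

definition syt_sigma :: "nat \<Rightarrow> tableau \<Rightarrow> nat" where
  "syt_sigma i T =
     (if i \<in> set (column 1 T) then i - col 1 (subtableau T i) + 1
      else let k = (THE k. 1 \<le> k \<and> i \<in> set (column (k + 1) T))
           in col k (subtableau T i) - col (k + 1) (subtableau T i) + 1)"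

text \<open>An ordered weak set partition \<open>(B\<^sub>0, \<dots>, B\<^sub>n)\<close> is a list of \<open>n + 1\<close> sets.\<close>

definition OWP :: "nat \<Rightarrow> nat set list set" where
  "OWP n = {p.
     length p = n + 1 \<and>
     \<Union> (set p) = {1..n} \<and>
     (\<forall>i\<le>n. \<forall>j\<le>n. i \<noteq> j \<longrightarrow> p ! i \<inter> p ! j = {}) \<and>
     1 \<in> p ! 0 \<and>
     (\<forall>i\<in>{1..n}. p ! i \<noteq> {} \<longrightarrow> i < Min (p ! i))}"

definition sort_columns :: "tableau \<Rightarrow> tableau" where
  "sort_columns R =
     map (\<lambda>i. map (\<lambda>k. sort (column k R) ! i) [1..<length (R ! i) + 1]) [0..<length R]"

text \<open>The order of rows of equal length is immaterial, because the columns are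
  sorted afterwards.\<close>

definition phi :: "nat set list \<Rightarrow> tableau" where
  "phi p = sort_columns
     (rev (sort_key length (filter (\<lambda>r. r \<noteq> []) (map sorted_list_of_set p))))"

definition phi_fiber :: "nat \<Rightarrow> tableau \<Rightarrow> nat set list set" where
  "phi_fiber n T = {p \<in> OWP n. phi p = T}"

text \<open>Infinite differentiability on an open set of reals. The value of \<^const>\<open>deriv\<close> at a point
  depends only on the germ of the function there, so iterating it is unproblematic although
  the functions are total.\<close>

definition smooth_on :: "real set \<Rightarrow> (real \<Rightarrow> real) \<Rightarrow> bool" where
  "smooth_on S c \<longleftrightarrow> open S \<and> (\<forall>k. \<forall>x\<in>S. (deriv ^^ k) c differentiable (at x))"

definition cD :: "(real \<Rightarrow> real) \<Rightarrow> (real \<Rightarrow> real) \<Rightarrow> real \<Rightarrow> real" where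
  "cD c g = (\<lambda>x. c x * deriv g x)"

definition tableau_weight :: "nat \<Rightarrow> (real \<Rightarrow> real) \<Rightarrow> tableau \<Rightarrow> real \<Rightarrow> real" where
  "tableau_weight n c T x =
     c x ^ (n + 1 - num_rows T) * (\<Prod>i=1..n. (deriv ^^ i) c x ^ w_rows i T)"

end

theory Submission
  imports Defs
begin

text \<open>
  An ordered weak set partition is built by inserting \<open>1, \<dots>, n\<close> in turn: when \<open>i\<close> arrives there
  are \<open>i\<close> blocks \<open>B\<^sub>0, \<dots>, B\<^sub>i\<^sub>-\<^sub>1\<close> to choose from. The tableau \<open>\<phi>(p)\<close> is
  determined by the set of entries in each column, and \<open>i\<close> ends up in column \<open>k\<close> iff it is inserted
  into a block of size \<open>k - 1\<close>. The number of such blocks depends only on how many smaller entries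
  lie in columns \<open>k - 1\<close> and \<open>k\<close>, and it equals \<open>\<sigma>\<^sub>i(T)\<close>; this gives the product formula. On
  the analytic side, each term of \<open>(cD)\<^sup>n c\<close> is a product of derivatives of \<open>c\<close>, one for each block
  \<open>B\<^sub>0, \<dots>, B\<^sub>n\<close>, the order of the derivative being the size of the block, and applying \<open>cD\<close>
  once more inserts \<open>n + 1\<close> in all possible ways.
\<close>

section \<open>Columns\<close>

lemma col_conv_filter: "col k T = length (filter (\<lambda>r. k \<le> length r) T)"
  by (simp add: col_def column_def)

lemma set_column: "set (column k T) = {r ! (k - 1) | r. r \<in> set T \<and> k \<le> length r}"
  by (auto simp: column_def)

lemma set_column_subset: "1 \<le> k \<Longrightarrow> set (column k T) \<subseteq> set (concat T)"
  by (auto simp: set_column intro!: bexI nth_mem)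

lemma set_concat_columns: "set (concat T) = (\<Union>k\<in>{1..}. set (column k T))"
proof
  show "set (concat T) \<subseteq> (\<Union>k\<in>{1..}. set (column k T))"
  proof
    fix a assume "a \<in> set (concat T)"
    then obtain r where r: "r \<in> set T" "a \<in> set r" by auto
    then obtain i where "i < length r" "r ! i = a" by (auto simp: in_set_conv_nth)
    then have "a \<in> set (column (Suc i) T)" using r by (auto simp: set_column)
    then show "a \<in> (\<Union>k\<in>{1..}. set (column k T))" by (intro UN_I[of "Suc i"]) simp_all
  qed
  show "(\<Union>k\<in>{1..}. set (column k T)) \<subseteq> set (concat T)"
    by (intro UN_least set_column_subset) simp
qed

lemma distinct_column:
  assumes "distinct (concat T)" "1 \<le> k"
  shows "distinct (column k T)"
  using assms
proof (induction T)
  case (Cons r T)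
  have "r ! (k - 1) \<notin> set (column k T)" if "k \<le> length r"
  proof -
    have "r ! (k - 1) \<in> set r" using that Cons.prems by simp
    then show ?thesis using Cons.prems set_column_subset[of k T] by auto
  qed
  then show ?case using Cons by (auto simp: column_def)
qed (simp add: column_def)

lemma col_le_length: "col k T \<le> length T"
  by (simp add: col_conv_filter)

lemma col_eq_card: "distinct (concat T) \<Longrightarrow> 1 \<le> k \<Longrightarrow> col k T = card (set (column k T))"
  by (simp add: col_def distinct_card distinct_column)

lemma filter_long_rows_eq_take:
  "sorted_wrt (\<ge>) (map length T) \<Longrightarrow> filter (\<lambda>r. k \<le> length r) T = take (col k T) T"
proof (induction T)
  case (Cons r T)
  show ?case
  proof (cases "k \<le> length r")
    case True
    then have "col k (r # T) = Suc (col k T)" by (simp add: col_conv_filter)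
    then show ?thesis using Cons True by simp
  next
    case False
    then have "filter (\<lambda>s. k \<le> length s) (r # T) = []"
      using Cons.prems by (auto simp: filter_empty_conv)
    then show ?thesis unfolding col_conv_filter by simp
  qed
qed simp

text \<open>This is the duality between a partition and its conjugate: row lengths weakly decrease,
  so the rows that reach column \<open>k\<close> form an initial segment, of length
  \<open>col k T\<close>.\<close>

lemma le_length_row_iff:
  "sorted_wrt (\<ge>) (map length T) \<Longrightarrow> i < length T \<Longrightarrow> k \<le> length (T ! i) \<longleftrightarrow> i < col k T"
proof (induction T arbitrary: i)
  case (Cons r T)
  show ?case
  proof (cases i)
    case 0
    have "filter (\<lambda>r. k \<le> length r) T = []" if "\<not> k \<le> length r"
      using Cons.prems that by (auto simp: filter_empty_conv)
    then show ?thesis by (auto simp: 0 col_conv_filter)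
  next
    case (Suc j)
    have "length (T ! j) \<le> length r" using Cons.prems Suc by auto
    moreover have "k \<le> length (T ! j) \<longleftrightarrow> j < col k T" using Cons Suc by auto
    moreover have "col k T = 0" if "\<not> k \<le> length r"
      using Cons.prems that by (auto simp: col_conv_filter filter_empty_conv)
    ultimately show ?thesis by (auto simp: Suc col_conv_filter)
  qed
qed simp

lemma column_nth:
  assumes "sorted_wrt (\<ge>) (map length T)" "i < col k T"
  shows "column k T ! i = T ! i ! (k - 1)"
proof -
  have "i < length T" using assms(2) col_le_length by (rule less_le_trans)
  then show ?thesis
    using assms(2) unfolding column_def filter_long_rows_eq_take[OF assms(1)] by simp
qed

lemma col_1_eq_length: "[] \<notin> set T \<Longrightarrow> col 1 T = length T"
  unfolding col_conv_filter by (subst filter_True) (auto simp: Suc_le_eq)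

text \<open>The columns determine the shape: their sizes fix every row length through
  \<open>le_length_row_iff\<close>, and with no empty rows the first column fixes the number of
  rows. Each entry can then be read off from its column.\<close>

lemma tableau_eqI:
  assumes T: "sorted_wrt (\<ge>) (map length T)" "[] \<notin> set T"
    and U: "sorted_wrt (\<ge>) (map length U)" "[] \<notin> set U"
    and eq: "\<And>k. 1 \<le> k \<Longrightarrow> column k T = column k U"
  shows "T = U"
proof -
  have col: "col k T = col k U" if "1 \<le> k" for k
    using eq[OF that] by (simp add: col_def)
  have len: "length T = length U"
    using col[of 1] T U by (simp add: col_1_eq_length del: One_nat_def)
  show ?thesis
  proof (rule nth_equalityI[OF len])
    fix i assume i: "i < length T"
    have le: "k \<le> length (T ! i) \<longleftrightarrow> k \<le> length (U ! i)" for k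
    proof (cases "1 \<le> k")
      case True
      then show ?thesis
        using col[OF True] le_length_row_iff[OF T(1) i, of k] le_length_row_iff[OF U(1), of i k] i len
        by simp
    qed simp
    show "T ! i = U ! i"
    proof (rule nth_equalityI)
      show "length (T ! i) = length (U ! i)"
        using le[of "length (T ! i)"] le[of "length (U ! i)"] by simp
    next
      fix j assume "j < length (T ! i)"
      then have "i < col (Suc j) T" using le_length_row_iff[OF T(1) i, of "Suc j"] by simp
      then have "T ! i ! j = column (Suc j) T ! i" "U ! i ! j = column (Suc j) U ! i"
        using column_nth[OF T(1), of i "Suc j"] column_nth[OF U(1), of i "Suc j"] col[of "Suc j"]
        by simp_all
      then show "T ! i ! j = U ! i ! j" using eq[of "Suc j"] by simp
    qed
  qed
qed

section \<open>Sorting the columns of an array\<close>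

lemma map_length_sort_columns: "map length (sort_columns R) = map length R"
  by (rule nth_equalityI) (auto simp: sort_columns_def simp del: upt_Suc)

text \<open>Sorting keeps the row lengths, hence the column sizes. As these lengths weakly decrease,
  position \<open>i\<close> of a column always belongs to row \<open>i\<close>, so the entries
  placed row by row reassemble into the sorted columns.\<close>

lemma column_sort_columns:
  assumes R: "sorted_wrt (\<ge>) (map length R)" and k: "1 \<le> k"
  shows "column k (sort_columns R) = sort (column k R)"
proof -
  have S: "sorted_wrt (\<ge>) (map length (sort_columns R))"
    using R by (simp add: map_length_sort_columns)
  have "length (filter (\<lambda>l. k \<le> l) (map length (sort_columns R)))
      = length (filter (\<lambda>l. k \<le> l) (map length R))"
    by (simp only: map_length_sort_columns)
  then have col: "col k (sort_columns R) = col k R"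
    by (simp add: col_conv_filter filter_map o_def)
  show ?thesis
  proof (rule nth_equalityI)
    show "length (column k (sort_columns R)) = length (sort (column k R))"
      using col by (simp add: col_def)
  next
    fix i assume "i < length (column k (sort_columns R))"
    then have i: "i < col k (sort_columns R)" by (simp add: col_def)
    then have iR: "i < length R" using col col_le_length[of k R] by simp
    then have le: "k \<le> length (R ! i)" using i col le_length_row_iff[OF R] by simp
    moreover have "[1..<length (R ! i) + 1] ! (k - 1) = k"
      using le k by (subst nth_upt) auto
    ultimately have "sort_columns R ! i ! (k - 1) = sort (column k R) ! i"
      using iR k by (simp add: sort_columns_def del: upt_Suc)
    then show "column k (sort_columns R) ! i = sort (column k R) ! i"
      using column_nth[OF S i] by simp
  qed
qed

text \<open>A counting argument with \<open>v = sort ys ! i\<close>: at least \<open>i + 1\<close>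
  positions of \<open>ys\<close> hold values at most \<open>v\<close>, and at each of them
  \<open>xs\<close> is strictly below \<open>v\<close>. If \<open>sort xs ! i\<close> were at least
  \<open>v\<close>, at most \<open>i\<close> values of \<open>xs\<close> could lie below
  \<open>v\<close>.\<close>

lemma sort_nth_less_sort_nth:
  fixes xs ys :: "'a::linorder list"
  assumes len: "length ys \<le> length xs" and less: "\<And>i. i < length ys \<Longrightarrow> xs ! i < ys ! i"
    and i: "i < length ys"
  shows "sort xs ! i < sort ys ! i"
proof (rule ccontr)
  assume nless: "\<not> sort xs ! i < sort ys ! i"
  define v where "v = sort ys ! i"
  \<comment> \<open>Sorting permutes the list, so elements may be counted by their positions after
    sorting.\<close>
  have filter_sort: "length (filter P zs) = card {j. j < length (sort zs) \<and> P (sort zs ! j)}"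
    for P and zs :: "'a list"
    unfolding length_filter_conv_card[symmetric] by (metis mset_filter mset_sort size_mset)
  have "card {..i} \<le> card {j. j < length (sort ys) \<and> sort ys ! j \<le> v}"
  proof (intro card_mono subsetI)
    fix j assume "j \<in> {..i}"
    then show "j \<in> {j. j < length (sort ys) \<and> sort ys ! j \<le> v}"
      using i sorted_nth_mono[OF sorted_sort, of j i ys] by (simp add: v_def)
  qed simp
  then have "Suc i \<le> length (filter (\<lambda>y. y \<le> v) ys)"
    by (simp add: filter_sort)
  also have "\<dots> \<le> length (filter (\<lambda>x. x < v) xs)"
    unfolding length_filter_conv_card
  proof (intro card_mono subsetI)
    fix j assume "j \<in> {j. j < length ys \<and> ys ! j \<le> v}"
    then show "j \<in> {j. j < length xs \<and> xs ! j < v}"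
      using len less[of j] by auto
  qed simp
  also have "\<dots> = card {j. j < length (sort xs) \<and> sort xs ! j < v}"
    by (rule filter_sort)
  also have "\<dots> \<le> card {..<i}"
  proof (intro card_mono subsetI)
    fix j assume j: "j \<in> {j. j < length (sort xs) \<and> sort xs ! j < v}"
    then have "\<not> i \<le> j"
      using nless sorted_nth_mono[OF sorted_sort, of i j xs] by (auto simp: v_def)
    then show "j \<in> {..<i}" by simp
  qed simp
  finally show False by simp
qed

text \<open>Sorting columns does not spoil increasing rows: before sorting, each column lies
  positionwise below its right neighbour, which is no longer than it, and
  \<open>sort_nth_less_sort_nth\<close> preserves this. By transitivity it suffices to compare
  adjacent entries.\<close>

lemma sort_columns_row_increasing:
  assumes R: "sorted_wrt (\<ge>) (map length R)" and rows: "\<And>r. r \<in> set R \<Longrightarrow> sorted_wrt (<) r"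
    and r: "r \<in> set (sort_columns R)"
  shows "sorted_wrt (<) r"
proof -
  obtain i where i: "i < length R"
    and r_eq: "r = map (\<lambda>k. sort (column k R) ! i) [1..<length (R ! i) + 1]"
    using r by (auto simp: sort_columns_def)
  have "sort (column (Suc k) R) ! i < sort (column (Suc (Suc k)) R) ! i"
    if k: "Suc k < length (R ! i)" for k
  proof (rule sort_nth_less_sort_nth)
    have le: "col (Suc (Suc k)) R \<le> col (Suc k) R"
      unfolding col_conv_filter length_filter_conv_card by (intro card_mono) auto
    then show "length (column (Suc (Suc k)) R) \<le> length (column (Suc k) R)"
      by (simp add: col_def)
    show "i < length (column (Suc (Suc k)) R)"
      using k le_length_row_iff[OF R i, of "Suc (Suc k)"] by (simp add: col_def)
    fix j assume "j < length (column (Suc (Suc k)) R)"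
    then have j: "j < col (Suc (Suc k)) R" by (simp add: col_def)
    then have jR: "j < length R" using col_le_length[of _ R] less_le_trans by blast
    then have "Suc k < length (R ! j)" using j le_length_row_iff[OF R jR, of "Suc (Suc k)"] by simp
    then have "R ! j ! k < R ! j ! Suc k"
      using rows[of "R ! j"] jR by (simp add: sorted_wrt_iff_nth_less)
    then show "column (Suc k) R ! j < column (Suc (Suc k)) R ! j"
      using column_nth[OF R j] column_nth[OF R, of j "Suc k"] j le by simp
  qed
  then have "r ! j < r ! Suc j" if "Suc j < length r" for j
    using that by (simp add: r_eq del: upt_Suc)
  then show ?thesis
    by (simp add: sorted_wrt_iff_nth_Suc_transp[OF transp_on_less])
qed

section \<open>Standard Young tableaux\<close>

lemma SYT_D:
  assumes "T \<in> SYT n"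
  shows "[] \<notin> set T" "sorted_wrt (\<ge>) (map length T)" "distinct (concat T)"
    "set (concat T) = {1..n}" "\<And>r. r \<in> set T \<Longrightarrow> sorted_wrt (<) r"
    "\<And>k. 1 \<le> k \<Longrightarrow> sorted_wrt (<) (column k T)"
  using assms by (auto simp: SYT_def)

text \<open>A strictly increasing column is determined by its set of entries. Equality of tableaux
  thus becomes equality of column sets, which are far easier to follow through
  \<open>phi\<close>.\<close>

lemma SYT_eqI:
  assumes T: "T \<in> SYT n" and U: "U \<in> SYT m"
    and eq: "\<And>k. 1 \<le> k \<Longrightarrow> set (column k T) = set (column k U)"
  shows "T = U"
proof (rule tableau_eqI)
  show "column k T = column k U" if "1 \<le> k" for k
    using SYT_D(6)[OF U that] SYT_D(6)[OF T that] eq[OF that] by (rule strict_sorted_equal)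
qed (use SYT_D[OF T] SYT_D[OF U] in blast)+

lemma SYT_length_row:
  assumes "T \<in> SYT n" "r \<in> set T"
  shows "1 \<le> length r" "length r \<le> n"
proof -
  show "1 \<le> length r" using SYT_D(1)[OF assms(1)] assms(2) by (cases r) auto
  have "distinct r" using SYT_D(5)[OF assms] by (simp add: strict_sorted_iff)
  then have "length r = card (set r)" by (simp add: distinct_card)
  also have "\<dots> \<le> card {1..n}"
    using SYT_D(4)[OF assms(1)] assms(2) by (intro card_mono) auto
  finally show "length r \<le> n" by simp
qed

lemma finite_SYT: "finite (SYT n)"
proof (rule finite_subset)
  let ?R = "{r. set r \<subseteq> {1..n} \<and> length r \<le> n}"
  show "SYT n \<subseteq> {T. set T \<subseteq> ?R \<and> length T \<le> n}"
  proof
    fix T assume T: "T \<in> SYT n"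
    have "length T \<le> n"
      using col_1_eq_length[OF SYT_D(1)[OF T]] col_eq_card[OF SYT_D(3)[OF T], of 1]
        card_mono[OF _ set_column_subset[of 1 T]] SYT_D(4)[OF T] by simp
    moreover have "set T \<subseteq> ?R"
      using SYT_D(4)[OF T] SYT_length_row(2)[OF T] by auto
    ultimately show "T \<in> {T. set T \<subseteq> ?R \<and> length T \<le> n}" by simp
  qed
  show "finite {T. set T \<subseteq> ?R \<and> length T \<le> n}"
    by (intro finite_lists_length_le) simp
qed

text \<open>Encodes a tableau by the function \<kappa> sending each entry to its column. Uniqueness
  of the column comes from distinctness, both across rows and within a row.\<close>

lemma SYT_column_function:
  assumes T: "T \<in> SYT n"
  obtains \<kappa> :: "nat \<Rightarrow> nat" where "\<And>a. 1 \<le> \<kappa> a"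
    "\<And>k. 1 \<le> k \<Longrightarrow> set (column k T) = {a \<in> {1..n}. \<kappa> a = k}"
proof -
  have uniq: "k = l" if a: "a \<in> set (column k T)" "a \<in> set (column l T)" and "1 \<le> k" "1 \<le> l"
    for a k l
  proof -
    obtain r where r: "r \<in> set T" "k \<le> length r" "r ! (k - 1) = a"
      using a by (auto simp: set_column)
    obtain s where s: "s \<in> set T" "l \<le> length s" "s ! (l - 1) = a"
      using a by (auto simp: set_column)
    have less: "k - 1 < length r" "l - 1 < length s" using r s that by auto
    then have "a \<in> set r \<inter> set s" using r(3) s(3) by (metis IntI nth_mem)
    then have "r = s" using SYT_D(3)[OF T] r s by (auto simp: distinct_concat_iff)
    moreover have "distinct r" using SYT_D(5)[OF T r(1)] by (simp add: strict_sorted_iff)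
    ultimately have "k - 1 = l - 1"
      using r(3) s(3) less by (metis nth_eq_iff_index_eq)
    then show ?thesis using that by simp
  qed
  \<comment> \<open>The implication makes \<kappa> total: outside \<open>{1..n}\<close> any positive
    value will do.\<close>
  have "\<exists>k\<ge>1. a \<in> {1..n} \<longrightarrow> a \<in> set (column k T)" for a
    proof (cases "a \<in> {1..n}")
    case True
    then have "a \<in> (\<Union>k\<in>{1..}. set (column k T))"
      using SYT_D(4)[OF T] set_concat_columns[of T] by blast
    then show ?thesis by auto
  qed auto
  then obtain \<kappa> where \<kappa>: "\<And>a. 1 \<le> \<kappa> a" "\<And>a. a \<in> {1..n} \<Longrightarrow> a \<in> set (column (\<kappa> a) T)"
    by metis
  have "set (column k T) = {a \<in> {1..n}. \<kappa> a = k}" if "1 \<le> k" for k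
    using uniq[OF _ _ that] \<kappa> set_column_subset[OF that, of T] SYT_D(4)[OF T] by blast
  with \<kappa>(1) show thesis by (rule that)
qed

section \<open>Ordered weak set partitions\<close>

text \<open>The condition \<open>1 \<in> B\<^sub>0\<close> is left implicit, so that the recursion over \<open>n\<close> can start from
  \<open>n = 0\<close>, where \<open>OWP 0\<close> is empty.\<close>

definition placements :: "nat \<Rightarrow> nat set list set" where
  "placements n = {p. length p = n + 1 \<and> \<Union> (set p) = {1..n} \<and>
     (\<forall>i\<le>n. \<forall>j\<le>n. i \<noteq> j \<longrightarrow> p ! i \<inter> p ! j = {}) \<and> (\<forall>i\<le>n. \<forall>a\<in>p ! i. i < a)}"

lemma placementsD:
  assumes "p \<in> placements n"
  shows "length p = Suc n" "\<Union> (set p) = {1..n}"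
    "\<And>i j. i \<le> n \<Longrightarrow> j \<le> n \<Longrightarrow> i \<noteq> j \<Longrightarrow> p ! i \<inter> p ! j = {}"
    "\<And>i a. i \<le> n \<Longrightarrow> a \<in> p ! i \<Longrightarrow> i < a"
    "\<And>B. B \<in> set p \<Longrightarrow> finite B" "\<And>i. i \<le> n \<Longrightarrow> p ! i \<subseteq> {1..n}"
proof -
  show "length p = Suc n" "\<Union> (set p) = {1..n}"
    "\<And>i j. i \<le> n \<Longrightarrow> j \<le> n \<Longrightarrow> i \<noteq> j \<Longrightarrow> p ! i \<inter> p ! j = {}"
    "\<And>i a. i \<le> n \<Longrightarrow> a \<in> p ! i \<Longrightarrow> i < a"
    using assms by (auto simp: placements_def)
  then have sub: "B \<subseteq> {1..n}" if "B \<in> set p" for B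
    using that by blast
  then show "\<And>B. B \<in> set p \<Longrightarrow> finite B"
    using finite_subset by blast
  show "p ! i \<subseteq> {1..n}" if "i \<le> n" for i
    using \<open>length p = Suc n\<close> that by (intro sub nth_mem) simp
qed

lemma set_eq_nth_image: "length p = Suc n \<Longrightarrow> set p = (\<lambda>i. p ! i) ` {..n}"
  by (auto simp: set_conv_nth less_Suc_eq_le)

lemma Union_set_nth: "length p = Suc n \<Longrightarrow> \<Union> (set p) = (\<Union>i\<le>n. p ! i)"
  by (simp add: set_eq_nth_image)

text \<open>The bound on the minimum of a block is a bound on all its elements, and for block 0 it
  only says that entries are positive. Conversely, the entry 1 can only lie in a block with index
  below 1.\<close>

lemma OWP_eq_placements:
  assumes "n \<ge> 1"
  shows "OWP n = placements n"
proof (intro set_eqI)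
  fix p :: "nat set list"
  have fin: "finite (p ! i)" if "length p = n + 1" "\<Union> (set p) = {1..n}" "i \<le> n" for i
  proof -
    have "p ! i \<in> set p" using that by simp
    then have "p ! i \<subseteq> {1..n}" using that(2) by blast
    then show ?thesis by (rule finite_subset) simp
  qed
  show "p \<in> OWP n \<longleftrightarrow> p \<in> placements n"
  proof
    assume p: "p \<in> OWP n"
    then have len: "length p = n + 1" and Un: "\<Union> (set p) = {1..n}" by (auto simp: OWP_def)
    have "i < a" if "i \<le> n" "a \<in> p ! i" for i a
    proof (cases "i = 0")
      case True
      have "a \<in> {1..n}" using Un len that nth_mem[of i p] by auto
      then show ?thesis using True by simp
    next
      case False
      then have "i < Min (p ! i)" using p that by (auto simp: OWP_def)
      also have "\<dots> \<le> a" using fin[OF len Un that(1)] that(2) by simp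
      finally show ?thesis .
    qed
    then show "p \<in> placements n" using p by (auto simp: OWP_def placements_def)
  next
    assume p: "p \<in> placements n"
    then have len: "length p = n + 1" and Un: "\<Union> (set p) = {1..n}"
      using placementsD[OF p] by simp_all
    have "i < Min (p ! i)" if "i \<in> {1..n}" "p ! i \<noteq> {}" for i
      using that fin[OF len Un, of i] placementsD(4)[OF p, of i] by simp
    moreover have "1 \<in> p ! 0"
    proof -
      have "1 \<in> \<Union> (set p)" using Un assms by simp
      then obtain i where "i \<le> n" "1 \<in> p ! i" using len by (auto simp: in_set_conv_nth less_Suc_eq_le)
      then show ?thesis using placementsD(4)[OF p, of i 1] by simp
    qed
    ultimately show "p \<in> OWP n" using p by (auto simp: OWP_def placements_def)
  qed
qed

section \<open>The map \<open>phi\<close> into standard Young tableaux\<close>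

abbreviation rows :: "nat set list \<Rightarrow> tableau" where
  "rows p \<equiv> map sorted_list_of_set p"

lemma set_concat_rows:
  assumes "\<And>B. B \<in> set p \<Longrightarrow> finite B"
  shows "set (concat (rows p)) = \<Union> (set p)"
  using assms by (induction p) simp_all

lemma set_concat_rows_placements: "p \<in> placements n \<Longrightarrow> set (concat (rows p)) = {1..n}"
  using set_concat_rows[of p] placementsD(2,5)[of p n] by blast

lemma distinct_concat_rows:
  assumes "p \<in> placements n"
  shows "distinct (concat (rows p))"
proof -
  have "distinct (concat (rows p))"
    if "sorted_wrt (\<lambda>A B. A \<inter> B = {}) p" "\<And>B. B \<in> set p \<Longrightarrow> finite B"
    using that
  proof (induction p)
    case (Cons B p)
    have "set (concat (rows p)) = \<Union> (set p)" using Cons.prems by (intro set_concat_rows) simp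
    then have "set (sorted_list_of_set B) \<inter> set (concat (rows p)) = {}"
      using Cons.prems by auto
    then show ?case using Cons by simp
  qed simp
  moreover have "sorted_wrt (\<lambda>A B. A \<inter> B = {}) p"
    using placementsD(1,3)[OF assms] by (simp add: sorted_wrt_iff_nth_less)
  ultimately show ?thesis using placementsD(5)[OF assms] by blast
qed

text \<open>The stage of \<open>phi\<close> that precedes the sorting of columns, separated so that
  the two can be analysed independently.\<close>

definition arrange_rows :: "tableau \<Rightarrow> tableau" where
  "arrange_rows R = rev (sort_key length (filter (\<lambda>r. r \<noteq> []) R))"

lemma phi_eq: "phi p = sort_columns (arrange_rows (rows p))"
  by (simp add: phi_def arrange_rows_def)

lemma mset_arrange_rows: "mset (arrange_rows R) = mset (filter (\<lambda>r. r \<noteq> []) R)"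
  by (simp add: arrange_rows_def)

lemma set_arrange_rows: "set (arrange_rows R) = set R - {[]}"
  by (auto simp: arrange_rows_def)

lemma sorted_arrange_rows: "sorted_wrt (\<ge>) (map length (arrange_rows R))"
  by (simp add: arrange_rows_def rev_map[symmetric] sorted_wrt_rev)

lemma mset_concat_arrange_rows: "mset (concat (arrange_rows R)) = mset (concat R)"
proof -
  have "mset (concat (arrange_rows R)) = mset (concat (filter (\<lambda>r. r \<noteq> []) R))"
    unfolding mset_concat sum_mset_sum_list[symmetric] mset_map mset_arrange_rows ..
  also have "concat (filter (\<lambda>r. r \<noteq> []) R) = concat R"
    by (induction R) auto
  finally show ?thesis .
qed

lemma set_column_arrange_rows:
  assumes "1 \<le> k"
  shows "set (column k (arrange_rows R)) = set (column k R)"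
proof -
  have "r \<in> set (arrange_rows R) \<and> k \<le> length r \<longleftrightarrow> r \<in> set R \<and> k \<le> length r" for r
    using assms by (auto simp: set_arrange_rows)
  then show ?thesis by (simp add: set_column)
qed

text \<open>Permuting rows, dropping empty ones and sorting within columns all leave every entry in
  its column, so the column sets of \<open>phi p\<close> are visible in the raw array of
  blocks.\<close>

lemma set_column_phi: "1 \<le> k \<Longrightarrow> set (column k (phi p)) = set (column k (rows p))"
  by (simp add: phi_eq column_sort_columns sorted_arrange_rows set_column_arrange_rows)

lemma phi_in_SYT:
  assumes p: "p \<in> placements n"
  shows "phi p \<in> SYT n"
proof -
  let ?R = "arrange_rows (rows p)"
  have len: "map length (phi p) = map length ?R"
    by (simp add: phi_eq map_length_sort_columns)
  have dist: "distinct (concat ?R)"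
    using distinct_concat_rows[OF p] mset_concat_arrange_rows[of "rows p"]
    by (metis mset_eq_imp_distinct_iff)
  have set_eq: "set (concat (phi p)) = {1..n}"
    using set_concat_rows_placements[OF p] by (simp only: set_concat_columns) (simp add: set_column_phi)
  \<comment> \<open>Distinctness follows by counting: the tableau has \<open>n\<close> boxes and its
    entries exhaust \<open>{1..n}\<close>.\<close>
  have "length (concat (phi p)) = length (concat ?R)"
    by (simp only: length_concat len)
  also have "\<dots> = card {1..n}"
    using dist set_concat_rows_placements[OF p] mset_concat_arrange_rows[of "rows p"]
    by (metis distinct_card mset_eq_setD)
  finally have "distinct (concat (phi p))"
    unfolding set_eq[symmetric] by (intro card_distinct) simp
  moreover have "[] \<notin> set (phi p)"
  proof
    assume "[] \<in> set (phi p)"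
    then have "0 \<in> set (map length ?R)" unfolding len[symmetric] by force
    then obtain r where "r \<in> set ?R" "length r = 0" by auto
    then show False using set_arrange_rows[of "rows p"] by blast
  qed
  moreover have "sorted_wrt (\<ge>) (map length (phi p))"
    using sorted_arrange_rows len by simp
  moreover have "sorted_wrt (<) r" if "r \<in> set (phi p)" for r
    using that unfolding phi_eq
    by (rule sort_columns_row_increasing[OF sorted_arrange_rows, rotated])
      (auto simp: set_arrange_rows)
  moreover have "sorted_wrt (<) (column k (phi p))" if "1 \<le> k" for k
    using distinct_column[OF dist that]
    by (simp add: phi_eq column_sort_columns[OF sorted_arrange_rows that] strict_sorted_iff)
  ultimately show ?thesis using set_eq by (simp add: SYT_def)
qed

text \<open>Turns membership in a fiber into a condition on the raw array, where the effect of
  inserting an entry can be computed.\<close>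

lemma phi_eq_iff:
  assumes "p \<in> placements n" "T \<in> SYT n"
  shows "phi p = T \<longleftrightarrow> (\<forall>k\<ge>1. set (column k (rows p)) = set (column k T))"
  using SYT_eqI[OF phi_in_SYT[OF assms(1)] assms(2)] set_column_phi[of _ p] by metis

section \<open>Inserting the largest entry\<close>

text \<open>The appended empty set is the new block with index \<open>Suc n\<close>, which can
  contain nothing because its elements would have to exceed \<open>Suc n\<close>.\<close>

definition insert_entry :: "nat \<Rightarrow> nat set list \<Rightarrow> nat \<Rightarrow> nat set list" where
  "insert_entry n p j = p[j := insert (Suc n) (p ! j)] @ [{}]"

lemma length_insert_entry: "length (insert_entry n p j) = Suc (length p)"
  by (simp add: insert_entry_def)

lemma nth_insert_entry:
  assumes "length p = Suc n" "i \<le> Suc n"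
  shows "insert_entry n p j ! i =
    (if i = Suc n then {} else if i = j then insert (Suc n) (p ! j) else p ! i)"
  using assms by (auto simp: insert_entry_def nth_append)

lemma insert_entry_in_placements:
  assumes p: "p \<in> placements n" and j: "j \<le> n"
  shows "insert_entry n p j \<in> placements (Suc n)"
proof -
  note len = placementsD(1)[OF p]
  note nth = nth_insert_entry[OF len]
  have sub: "a \<le> n" if "a \<in> p ! i" "i \<le> n" for a i
    using placementsD(6)[OF p that(2)] that(1) by auto
  have "\<Union> (set (insert_entry n p j)) = (\<Union>i\<le>Suc n. insert_entry n p j ! i)"
    using len by (intro Union_set_nth) (simp add: length_insert_entry)
  also have "\<dots> = insert (Suc n) (\<Union>i\<le>n. p ! i)"
    using j by (auto simp: nth atMost_Suc split: if_splits)
  also have "(\<Union>i\<le>n. p ! i) = \<Union> (set p)"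
    using Union_set_nth[OF len] by simp
  also have "insert (Suc n) \<dots> = {1..Suc n}"
    using placementsD(2)[OF p] by auto
  finally have "\<Union> (set (insert_entry n p j)) = {1..Suc n}" .
  moreover have "insert_entry n p j ! i \<inter> insert_entry n p j ! i' = {}"
    if "i \<le> Suc n" "i' \<le> Suc n" "i \<noteq> i'" for i i'
    using that sub[of "Suc n" i] sub[of "Suc n" i'] placementsD(3)[OF p, of i i']
    by (auto simp: nth le_Suc_eq)
  moreover have "i < a" if "i \<le> Suc n" "a \<in> insert_entry n p j ! i" for i a
    using that placementsD(4)[OF p, of i a] by (auto simp: nth le_Suc_eq split: if_splits)
  ultimately show ?thesis
    using len by (simp add: placements_def length_insert_entry)
qed

text \<open>The inverse deletes \<open>Suc n\<close> from its block and drops the last block, which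
  is necessarily empty. The index \<open>j\<close> is recovered as that of the only block containing
  \<open>Suc n\<close>.\<close>

lemma placements_Suc:
  "bij_betw (\<lambda>(p, j). insert_entry n p j) (placements n \<times> {..n}) (placements (Suc n))"
proof (rule bij_betw_imageI)
  show "inj_on (\<lambda>(p, j). insert_entry n p j) (placements n \<times> {..n})"
  proof -
    have "p = q \<and> j = l" if p: "p \<in> placements n" and q: "q \<in> placements n"
      and jl: "j \<in> {..n}" "l \<in> {..n}" and eq: "insert_entry n p j = insert_entry n q l" for p j q l
    proof -
      note nth_p = nth_insert_entry[OF placementsD(1)[OF p]]
        and nth_q = nth_insert_entry[OF placementsD(1)[OF q]]
      have notin: "Suc n \<notin> p ! i" "Suc n \<notin> q ! i" if "i \<le> n" for i
        using placementsD(6)[OF p that] placementsD(6)[OF q that] by auto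
      have "insert_entry n q l ! j = insert (Suc n) (p ! j)"
        using nth_p[of j j] jl by (simp add: eq[symmetric])
      then have "j = l" using nth_q[of j l] notin(2)[of j] jl by (auto split: if_splits)
      moreover have "p = q"
      proof (rule nth_equalityI)
        show "length p = length q" using placementsD(1)[OF p] placementsD(1)[OF q] by simp
        fix i assume "i < length p"
        then have i: "i \<le> n" using placementsD(1)[OF p] by simp
        have "insert_entry n p j ! i - {Suc n} = p ! i" "insert_entry n q l ! i - {Suc n} = q ! i"
          using nth_p[of i j] nth_q[of i l] i notin[OF i] by auto
        then show "p ! i = q ! i" using eq by simp
      qed
      ultimately show "p = q \<and> j = l" by simp
    qed
    then show ?thesis by (auto simp: inj_on_def)
  qed
  show "(\<lambda>(p, j). insert_entry n p j) ` (placements n \<times> {..n}) = placements (Suc n)"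
  proof (intro equalityI subsetI)
    fix q assume "q \<in> (\<lambda>(p, j). insert_entry n p j) ` (placements n \<times> {..n})"
    then show "q \<in> placements (Suc n)" using insert_entry_in_placements by auto
  next
    fix q assume q: "q \<in> placements (Suc n)"
    note D = placementsD[OF q]
    define p where "p = map (\<lambda>i. q ! i - {Suc n}) [0..<Suc n]"
    have p_nth: "p ! i = q ! i - {Suc n}" if "i \<le> n" for i
      using that by (simp add: p_def del: upt_Suc)
    have len_p: "length p = Suc n" by (simp add: p_def)
    have last: "q ! Suc n = {}"
    proof (rule equals0I)
      fix a assume "a \<in> q ! Suc n"
      then show False using D(4)[of "Suc n" a] D(6)[of "Suc n"] by auto
    qed
    have Un: "(\<Union>i\<le>Suc n. q ! i) = {1..Suc n}"
      using Union_set_nth[OF D(1)] D(2) by simp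
    then have "Suc n \<in> (\<Union>i\<le>Suc n. q ! i)" by simp
    then obtain j where j: "j \<le> n" "Suc n \<in> q ! j"
      using last by (auto simp: le_Suc_eq)
    have uniq: "Suc n \<notin> q ! i" if "i \<le> n" "i \<noteq> j" for i
      using D(3)[of i j] that j by auto
    have "p \<in> placements n"
    proof -
      have "\<Union> (set p) = (\<Union>i\<le>n. p ! i)"
        using Union_set_nth[OF len_p] by simp
      also have "\<dots> = (\<Union>i\<le>Suc n. q ! i) - {Suc n}"
        using last by (auto simp: p_nth atMost_Suc)
      also have "\<dots> = {1..n}" unfolding Un by auto
      finally have "\<Union> (set p) = {1..n}" .
      moreover have "p ! i \<inter> p ! l = {}" if "i \<le> n" "l \<le> n" "i \<noteq> l" for i l
        using D(3)[of i l] that by (auto simp: p_nth)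
      moreover have "i < a" if "i \<le> n" "a \<in> p ! i" for i a
        using D(4)[of i a] that by (auto simp: p_nth)
      ultimately show ?thesis using len_p by (simp add: placements_def)
    qed
    moreover have "q = insert_entry n p j"
    proof (rule nth_equalityI)
      show "length q = length (insert_entry n p j)"
        using D(1) len_p by (simp add: length_insert_entry)
      fix i assume "i < length q"
      then have "i \<le> Suc n" using D(1) by simp
      then show "q ! i = insert_entry n p j ! i"
        using last uniq[of i] j nth_insert_entry[OF len_p, of i j] p_nth[of i] by auto
    qed
    ultimately show "q \<in> (\<lambda>(p, j). insert_entry n p j) ` (placements n \<times> {..n})"
      using j by force
  qed
qed

lemma placements_0: "placements 0 = {[{}]}"
  by (auto simp: placements_def length_Suc_conv)

lemma finite_placements: "finite (placements n)"
proof (induction n)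
  case (Suc n)
  then show ?case using bij_betw_finite[OF placements_Suc] by blast
qed (simp add: placements_0)

text \<open>The recursion behind both halves of the theorem: applied to an indicator it counts
  fibers, applied to \<open>block_weight\<close> it matches the Leibniz rule.\<close>

lemma sum_placements_Suc:
  "(\<Sum>q\<in>placements (Suc n). f q) = (\<Sum>p\<in>placements n. \<Sum>j\<le>n. f (insert_entry n p j))"
  unfolding sum.cartesian_product sum.reindex_bij_betw[OF placements_Suc, symmetric]
  by (simp add: case_prod_unfold)

section \<open>How an insertion changes the columns\<close>

lemma sorted_list_of_set_insert_greater:
  fixes m :: nat
  assumes "finite A" "\<And>a. a \<in> A \<Longrightarrow> a < m"
  shows "sorted_list_of_set (insert m A) = sorted_list_of_set A @ [m]"
proof (rule strict_sorted_equal)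
  show "sorted_wrt (<) (sorted_list_of_set A @ [m])"
    using assms by (simp add: sorted_wrt_append)
  show "sorted_wrt (<) (sorted_list_of_set (insert m A))"
    by (rule strict_sorted_list_of_set)
  show "set (sorted_list_of_set (insert m A)) = set (sorted_list_of_set A @ [m])"
    using assms(1) by (subst set_sorted_list_of_set) auto
qed

lemma set_column_rows_nth:
  assumes "length p = Suc n"
  shows "set (column k (rows p)) =
    {sorted_list_of_set (p ! i) ! (k - 1) | i. i \<le> n \<and> k \<le> card (p ! i)}"
proof -
  have "set (column k (rows p)) = {sorted_list_of_set B ! (k - 1) | B. B \<in> set p \<and> k \<le> card B}"
    by (auto simp: set_column)
  then show ?thesis unfolding set_eq_nth_image[OF assms] by blast
qed

text \<open>The new entry exceeds all others, so it goes to the end of its row and lands one column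
  beyond the old size of the block; no other entry moves.\<close>

lemma set_column_insert_entry:
  assumes p: "p \<in> placements n" and j: "j \<le> n" and k: "1 \<le> k"
  shows "set (column k (rows (insert_entry n p j))) =
    set (column k (rows p)) \<union> (if k = Suc (card (p ! j)) then {Suc n} else {})"
proof -
  note len = placementsD(1)[OF p]
  let ?q = "insert_entry n p j"
  have fin: "finite (p ! j)" using placementsD(6)[OF p j] finite_subset by blast
  have "Suc n \<notin> p ! j" using placementsD(6)[OF p j] by auto
  then have card_j: "card (insert (Suc n) (p ! j)) = Suc (card (p ! j))" using fin by simp
  have list_j: "sorted_list_of_set (insert (Suc n) (p ! j)) = sorted_list_of_set (p ! j) @ [Suc n]"
    using placementsD(6)[OF p j] fin by (intro sorted_list_of_set_insert_greater) auto
  \<comment> \<open>\<open>e P i\<close> is the contribution of block \<open>i\<close> to column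
    \<open>k\<close>, at most one entry; only that of block \<open>j\<close> changes.\<close>
  define e where "e P i = (if k \<le> card (P ! i) then {sorted_list_of_set (P ! i) ! (k - 1)} else {})"
    for P :: "nat set list" and i
  have "set (column k (rows ?q)) = (\<Union>i\<le>Suc n. e ?q i)"
    using len unfolding e_def
    by (subst set_column_rows_nth[of _ "Suc n"]) (auto simp: length_insert_entry split: if_splits)
  also have "\<dots> = (\<Union>i\<le>n. e ?q i)"
  proof -
    have "e ?q (Suc n) = {}" using k by (simp add: e_def nth_insert_entry[OF len])
    then show ?thesis by (simp add: atMost_Suc)
  qed
  also have "\<dots> = (\<Union>i\<in>{..n} - {j}. e ?q i) \<union> e ?q j" using j by auto
  also have "(\<Union>i\<in>{..n} - {j}. e ?q i) = (\<Union>i\<in>{..n} - {j}. e p i)"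
    by (intro SUP_cong) (auto simp: e_def nth_insert_entry[OF len])
  also have "e ?q j = e p j \<union> (if k = Suc (card (p ! j)) then {Suc n} else {})"
    using k j by (auto simp: e_def nth_insert_entry[OF len] card_j list_j nth_append)
  also have "(\<Union>i\<in>{..n} - {j}. e p i) \<union> \<dots> =
      (\<Union>i\<le>n. e p i) \<union> (if k = Suc (card (p ! j)) then {Suc n} else {})"
    using j by auto
  also have "(\<Union>i\<le>n. e p i) = set (column k (rows p))"
    unfolding set_column_rows_nth[OF len] e_def by (auto split: if_splits)
  finally show ?thesis .
qed

section \<open>Counting fibers\<close>

definition entries_upto :: "(nat \<Rightarrow> nat) \<Rightarrow> nat \<Rightarrow> nat \<Rightarrow> nat" where
  "entries_upto \<kappa> i k = card {a \<in> {1..i}. \<kappa> a = k}"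

text \<open>The number of blocks into which entry \<open>i\<close> can be inserted so that it lands in column
  \<open>\<kappa> i\<close>: blocks of size \<open>\<kappa> i - 1\<close> among \<open>B\<^sub>0, \<dots>, B\<^sub>i\<^sub>-\<^sub>1\<close>.\<close>

definition slots :: "(nat \<Rightarrow> nat) \<Rightarrow> nat \<Rightarrow> nat" where
  "slots \<kappa> i = (if \<kappa> i = 1 then i - entries_upto \<kappa> (i - 1) 1
     else entries_upto \<kappa> (i - 1) (\<kappa> i - 1) - entries_upto \<kappa> (i - 1) (\<kappa> i))"

text \<open>A fiber of \<open>phi\<close> when \<kappa> is the column function of a tableau.
  Allowing any \<kappa> lets the induction on \<open>n\<close> run without truncating
  tableaux.\<close>

definition placements_with_columns :: "(nat \<Rightarrow> nat) \<Rightarrow> nat \<Rightarrow> nat set list set" where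
  "placements_with_columns \<kappa> n =
     {p \<in> placements n. \<forall>k\<ge>1. set (column k (rows p)) = {a \<in> {1..n}. \<kappa> a = k}}"

lemma col_rows:
  assumes "length p = Suc n"
  shows "col k (rows p) = card {j. j \<le> n \<and> k \<le> card (p ! j)}"
  unfolding col_conv_filter length_filter_conv_card
  by (rule arg_cong[where f = card]) (use assms in \<open>auto simp: less_Suc_eq_le\<close>)

lemma card_blocks_of_size:
  assumes "length p = Suc n"
  shows "card {j. j \<le> n \<and> card (p ! j) = m} = col m (rows p) - col (Suc m) (rows p)"
proof -
  have "{j. j \<le> n \<and> card (p ! j) = m} =
      {j. j \<le> n \<and> m \<le> card (p ! j)} - {j. j \<le> n \<and> Suc m \<le> card (p ! j)}"
    by auto
  moreover have "{j. j \<le> n \<and> Suc m \<le> card (p ! j)} \<subseteq> {j. j \<le> n \<and> m \<le> card (p ! j)}"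
    by auto
  ultimately show ?thesis
    unfolding col_rows[OF assms] by (simp add: card_Diff_subset)
qed

text \<open>The key to the product formula: the column sizes of \<open>p\<close> depend only on
  \<kappa>, and their consecutive differences count the blocks of a given size. So every
  \<open>p\<close> offers the same number of admissible blocks for the next entry.\<close>

lemma card_blocks_eq_slots:
  assumes p: "p \<in> placements_with_columns \<kappa> n" and \<kappa>: "1 \<le> \<kappa> (Suc n)"
  shows "card {j. j \<le> n \<and> Suc (card (p ! j)) = \<kappa> (Suc n)} = slots \<kappa> (Suc n)"
proof -
  have P: "p \<in> placements n" and
    cols: "\<And>k. 1 \<le> k \<Longrightarrow> set (column k (rows p)) = {a \<in> {1..n}. \<kappa> a = k}"
    using p by (auto simp: placements_with_columns_def)
  note len = placementsD(1)[OF P]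
  have col: "col k (rows p) = entries_upto \<kappa> n k" if "1 \<le> k" for k
    unfolding entries_upto_def col_eq_card[OF distinct_concat_rows[OF P] that] cols[OF that] ..
  obtain m where m: "\<kappa> (Suc n) = Suc m" using \<kappa> by (cases "\<kappa> (Suc n)") auto
  have "card {j. j \<le> n \<and> Suc (card (p ! j)) = \<kappa> (Suc n)} = col m (rows p) - col (Suc m) (rows p)"
    unfolding card_blocks_of_size[OF len, symmetric] by (simp add: m)
  \<comment> \<open>Column number 0 counts all blocks, empty ones included; this explains the
    separate case \<kappa> = 1 in \<open>slots\<close>.\<close>
  moreover have "col 0 (rows p) = Suc n"
    using len by (simp add: col_conv_filter)
  ultimately show ?thesis
    using col[of m] col[of "Suc m"] by (cases "m = 0") (simp_all add: slots_def m)
qed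

text \<open>Since \<open>Suc n\<close> occurs in no column of \<open>p\<close>, each column
  condition splits into one about the old entries and one about where the new entry lands.\<close>

lemma insert_entry_in_placements_with_columns_iff:
  assumes p: "p \<in> placements n" and j: "j \<le> n" and \<kappa>: "\<And>a. 1 \<le> \<kappa> a"
  shows "insert_entry n p j \<in> placements_with_columns \<kappa> (Suc n) \<longleftrightarrow>
    p \<in> placements_with_columns \<kappa> n \<and> Suc (card (p ! j)) = \<kappa> (Suc n)"
proof -
  let ?C = "\<lambda>k. set (column k (rows p))" and ?N = "\<lambda>k. if k = Suc (card (p ! j)) then {Suc n} else {}"
  have sub: "?C k \<subseteq> {1..n}" if "1 \<le> k" for k
    using set_column_subset[OF that, of "rows p"] set_concat_rows_placements[OF p] by simp
  have split: "{a \<in> {1..Suc n}. \<kappa> a = k} =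
      {a \<in> {1..n}. \<kappa> a = k} \<union> (if k = \<kappa> (Suc n) then {Suc n} else {})" for k
    by (auto simp: le_Suc_eq)
  have step: "?C k \<union> ?N k = {a \<in> {1..Suc n}. \<kappa> a = k} \<longleftrightarrow>
      ?C k = {a \<in> {1..n}. \<kappa> a = k} \<and> (k = Suc (card (p ! j)) \<longleftrightarrow> k = \<kappa> (Suc n))"
    if "1 \<le> k" for k
  proof -
    have notin: "Suc n \<notin> ?C k" "Suc n \<notin> {a \<in> {1..n}. \<kappa> a = k}" using sub[OF that] by auto
    have "A \<union> (if P then {x} else {}) = B \<union> (if Q then {x} else {}) \<longleftrightarrow>
        A = B \<and> (P \<longleftrightarrow> Q)" if "x \<notin> A" "x \<notin> B" for A B :: "nat set" and x P Q
      using that by (cases P; cases Q) auto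
    from this[OF notin] show ?thesis unfolding split .
  qed
  have "insert_entry n p j \<in> placements_with_columns \<kappa> (Suc n) \<longleftrightarrow>
      (\<forall>k\<ge>1. set (column k (rows (insert_entry n p j))) = {a \<in> {1..Suc n}. \<kappa> a = k})"
    using insert_entry_in_placements[OF p j] by (simp add: placements_with_columns_def)
  also have "\<dots> \<longleftrightarrow> (\<forall>k\<ge>1. ?C k \<union> ?N k = {a \<in> {1..Suc n}. \<kappa> a = k})"
    by (intro all_cong1 imp_cong refl) (simp only: set_column_insert_entry[OF p j])
  also have "\<dots> \<longleftrightarrow> (\<forall>k\<ge>1. ?C k = {a \<in> {1..n}. \<kappa> a = k} \<and>
      (k = Suc (card (p ! j)) \<longleftrightarrow> k = \<kappa> (Suc n)))"
    by (intro all_cong1 imp_cong refl step)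
  also have "\<dots> \<longleftrightarrow> (\<forall>k\<ge>1. ?C k = {a \<in> {1..n}. \<kappa> a = k}) \<and>
      (\<forall>k\<ge>1. k = Suc (card (p ! j)) \<longleftrightarrow> k = \<kappa> (Suc n))"
    by blast
  also have "(\<forall>k\<ge>1. k = Suc (card (p ! j)) \<longleftrightarrow> k = \<kappa> (Suc n)) \<longleftrightarrow> Suc (card (p ! j)) = \<kappa> (Suc n)"
    using \<kappa>[of "Suc n"] by auto
  finally show ?thesis using p by (simp add: placements_with_columns_def)
qed

text \<open>Each admissible \<open>p\<close> extends in exactly
  \<open>slots \<kappa> (Suc n)\<close> ways. If no placement realises \<kappa>, the product has a
  zero factor.\<close>

lemma card_placements_with_columns:
  assumes \<kappa>: "\<And>a. 1 \<le> \<kappa> a"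
  shows "card (placements_with_columns \<kappa> n) = (\<Prod>i=1..n. slots \<kappa> i)"
proof (induction n)
  case 0
  have "placements_with_columns \<kappa> 0 = {[{}]}"
    by (auto simp: placements_with_columns_def placements_0 column_def)
  then show ?case by simp
next
  case (Suc n)
  let ?A = "placements_with_columns \<kappa>"
  have fin: "finite (?A m)" for m
    using finite_placements by (simp add: placements_with_columns_def)
  have "card (?A (Suc n)) = (\<Sum>q\<in>placements (Suc n). if q \<in> ?A (Suc n) then 1 else 0)"
    using finite_placements
    by (subst sum.inter_filter[symmetric]) (auto simp: placements_with_columns_def)
  also have "\<dots> = (\<Sum>p\<in>placements n. \<Sum>j\<le>n.
      if p \<in> ?A n \<and> Suc (card (p ! j)) = \<kappa> (Suc n) then 1 else 0)"
    unfolding sum_placements_Suc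
  proof (intro sum.cong refl)
    fix p j assume "p \<in> placements n" "j \<in> {..n}"
    then have "insert_entry n p j \<in> ?A (Suc n) \<longleftrightarrow> p \<in> ?A n \<and> Suc (card (p ! j)) = \<kappa> (Suc n)"
      by (intro insert_entry_in_placements_with_columns_iff \<kappa>) simp_all
    then show "(if insert_entry n p j \<in> ?A (Suc n) then 1 else 0) =
        (if p \<in> ?A n \<and> Suc (card (p ! j)) = \<kappa> (Suc n) then 1 else 0)"
      by (rule if_cong) simp_all
  qed
  also have "\<dots> = (\<Sum>p\<in>placements n. if p \<in> ?A n then slots \<kappa> (Suc n) else 0)"
  proof (rule sum.cong[OF refl])
    fix p
    show "(\<Sum>j\<le>n. if p \<in> ?A n \<and> Suc (card (p ! j)) = \<kappa> (Suc n) then 1 else 0) =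
        (if p \<in> ?A n then slots \<kappa> (Suc n) else 0)"
    proof (cases "p \<in> ?A n")
      case True
      have "(\<Sum>j\<le>n. if Suc (card (p ! j)) = \<kappa> (Suc n) then 1 else 0) =
          card {j \<in> {..n}. Suc (card (p ! j)) = \<kappa> (Suc n)}"
        by (subst sum.inter_filter[symmetric]) simp_all
      then show ?thesis using card_blocks_eq_slots[OF True \<kappa>] True by simp
    qed simp
  qed
  also have "\<dots> = (\<Sum>p\<in>?A n. slots \<kappa> (Suc n))"
    using finite_placements
    by (subst sum.inter_filter[symmetric]) (auto simp: placements_with_columns_def intro!: sum.cong)
  finally show ?case by (simp add: Suc.IH)
qed

section \<open>The statistic of a standard Young tableau\<close>

text \<open>In an increasing row the entries at most \<open>i\<close> form an initial segment, so
  deleting the others keeps the survivors in their columns.\<close>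

lemma le_length_filter_iff:
  fixes r :: "nat list"
  assumes "sorted_wrt (<) r" "1 \<le> k"
  shows "k \<le> length (filter (\<lambda>a. a \<le> i) r) \<longleftrightarrow> k \<le> length r \<and> r ! (k - 1) \<le> i"
  using assms
proof (induction r arbitrary: k)
  case (Cons x r)
  show ?case
  proof (cases "x \<le> i")
    case True
    show ?thesis
    proof (cases "k = 1")
      case False
      then have "k - 1 \<le> length (filter (\<lambda>a. a \<le> i) r) \<longleftrightarrow> k - 1 \<le> length r \<and> r ! (k - 1 - 1) \<le> i"
        using Cons by (intro Cons.IH) auto
      then show ?thesis using True False Cons.prems(2) by (auto simp: nth_Cons')
    qed (use True in auto)
  next
    case False
    then have "filter (\<lambda>a. a \<le> i) (x # r) = []" using Cons.prems(1) by (auto simp: filter_empty_conv)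
    moreover have "i < (x # r) ! (k - 1)" if "k \<le> length (x # r)"
    proof -
      have "(x # r) ! (k - 1) \<in> set (x # r)" using that Cons.prems(2) by (intro nth_mem) simp
      then show ?thesis using False Cons.prems(1) by auto
    qed
    ultimately show ?thesis using Cons.prems(2) by (auto simp del: filter.simps)
  qed
qed simp

lemma col_subtableau_conv_filter:
  assumes "1 \<le> k"
  shows "col k (subtableau T i) = length (filter (\<lambda>r. k \<le> length (filter (\<lambda>a. a \<le> i) r)) T)"
proof -
  have "(filter (\<lambda>a. a \<le> i) r \<noteq> [] \<and> k \<le> length (filter (\<lambda>a. a \<le> i) r)) =
      (k \<le> length (filter (\<lambda>a. a \<le> i) r))" for r
    using assms by (cases "filter (\<lambda>a. a \<le> i) r") auto
  then show ?thesis
    by (simp add: col_conv_filter subtableau_def filter_map o_def)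
qed

lemma col_subtableau_antimono:
  assumes "1 \<le> k" "k \<le> l"
  shows "col l (subtableau T i) \<le> col k (subtableau T i)"
  unfolding col_subtableau_conv_filter[OF assms(1)] length_filter_conv_card
    col_subtableau_conv_filter[OF order.trans[OF assms]]
  by (rule card_mono) (use assms(2) in auto)

lemma col_subtableau:
  assumes T: "T \<in> SYT n" and k: "1 \<le> k"
  shows "col k (subtableau T i) = card {a \<in> set (column k T). a \<le> i}"
proof -
  have "filter (\<lambda>r. k \<le> length (filter (\<lambda>a. a \<le> i) r)) T =
      filter (\<lambda>r. k \<le> length r \<and> r ! (k - 1) \<le> i) T"
    using SYT_D(5)[OF T] k by (intro filter_cong refl le_length_filter_iff)
  then have "col k (subtableau T i) = length (filter (\<lambda>r. k \<le> length r \<and> r ! (k - 1) \<le> i) T)"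
    unfolding col_subtableau_conv_filter[OF k] by simp
  also have "\<dots> = length (filter (\<lambda>a. a \<le> i) (column k T))"
    by (simp add: column_def filter_map o_def conj_commute)
  also have "\<dots> = card (set (filter (\<lambda>a. a \<le> i) (column k T)))"
    by (rule distinct_card[symmetric]) (rule distinct_filter[OF distinct_column[OF SYT_D(3)[OF T] k]])
  finally show ?thesis by simp
qed

text \<open>\<open>syt_sigma\<close> reads column sizes after \<open>i\<close> has been placed,
  \<open>slots\<close> before. The subtracted column contains \<open>i\<close> itself, and the added
  1 makes up for that box.\<close>

lemma syt_sigma_eq_slots:
  assumes T: "T \<in> SYT n" and \<kappa>: "\<And>a. 1 \<le> \<kappa> a"
    and cols: "\<And>k. 1 \<le> k \<Longrightarrow> set (column k T) = {a \<in> {1..n}. \<kappa> a = k}"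
    and i: "i \<in> {1..n}"
  shows "syt_sigma i T = slots \<kappa> i"
proof -
  have col: "col k (subtableau T i) = entries_upto \<kappa> (i - 1) k + (if k = \<kappa> i then 1 else 0)"
    if k: "1 \<le> k" for k
  proof -
    have "{a \<in> set (column k T). a \<le> i} = {a \<in> insert i {1..i - 1}. \<kappa> a = k}"
      using i by (auto simp: cols[OF k])
    also have "\<dots> = (if k = \<kappa> i then insert i {a \<in> {1..i - 1}. \<kappa> a = k}
        else {a \<in> {1..i - 1}. \<kappa> a = k})"
      by auto
    also have "card \<dots> = entries_upto \<kappa> (i - 1) k + (if k = \<kappa> i then 1 else 0)"
    proof -
      have "card (insert i {a \<in> {1..i - 1}. \<kappa> a = k}) = Suc (card {a \<in> {1..i - 1}. \<kappa> a = k})"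
        using i by (intro card_insert_disjoint) auto
      then show ?thesis unfolding entries_upto_def by (cases "k = \<kappa> i") simp_all
    qed
    finally show ?thesis unfolding col_subtableau[OF T k] .
  qed
  show ?thesis
  proof (cases "\<kappa> i = 1")
    case True
    \<comment> \<open>Rules out truncation: \<open>i - (e + 1) + 1 = i - e\<close> requires
      \<open>e < i\<close>.\<close>
    have "entries_upto \<kappa> (i - 1) 1 \<le> card {1..i - 1}"
      unfolding entries_upto_def by (intro card_mono) auto
    moreover have "i \<in> set (column 1 T)" using True i cols[of 1] by simp
    ultimately show ?thesis
      using col[of 1] i True by (simp add: syt_sigma_def slots_def) linarith
  next
    case False
    define k where "k = \<kappa> i - 1"
    have k: "1 \<le> k" "\<kappa> i = k + 1" using False \<kappa>[of i] by (auto simp: k_def)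
    have "i \<notin> set (column 1 T)" using False cols[of 1] by simp
    moreover have "(THE k. 1 \<le> k \<and> i \<in> set (column (k + 1) T)) = k"
      using k i by (intro the_equality) (auto simp: cols)
    ultimately have "syt_sigma i T = col k (subtableau T i) - col (k + 1) (subtableau T i) + 1"
      by (simp add: syt_sigma_def)
    \<comment> \<open>Column sizes of \<open>subtableau T i\<close> weakly decrease, so this
      difference does not truncate either.\<close>
    then show ?thesis
      using col[of k] col[of "k + 1"] k col_subtableau_antimono[of k "k + 1" T i]
      by (simp add: slots_def) linarith
  qed
qed

lemma card_phi_fiber:
  assumes n: "n \<ge> 1" and T: "T \<in> SYT n"
  shows "card (phi_fiber n T) = (\<Prod>i=1..n. syt_sigma i T)"
proof -
  obtain \<kappa> :: "nat \<Rightarrow> nat" where \<kappa>: "\<And>a. 1 \<le> \<kappa> a"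
    and cols: "\<And>k. 1 \<le> k \<Longrightarrow> set (column k T) = {a \<in> {1..n}. \<kappa> a = k}"
    using SYT_column_function[OF T] by blast
  have "phi_fiber n T = placements_with_columns \<kappa> n"
    unfolding phi_fiber_def placements_with_columns_def OWP_eq_placements[OF n]
    using phi_eq_iff[OF _ T] cols by auto
  then have "card (phi_fiber n T) = (\<Prod>i=1..n. slots \<kappa> i)"
    by (simp add: card_placements_with_columns[OF \<kappa>])
  also have "\<dots> = (\<Prod>i=1..n. syt_sigma i T)"
    by (intro prod.cong refl syt_sigma_eq_slots[OF T \<kappa> cols, symmetric])
  finally show ?thesis .
qed

section \<open>Weights\<close>

text \<open>Later \<open>f k\<close> is the \<open>k\<close>-th derivative of \<open>c\<close> at a
  fixed point, so an empty block contributes a factor \<open>c\<close>.\<close>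

definition block_weight :: "nat \<Rightarrow> (nat \<Rightarrow> real) \<Rightarrow> nat set list \<Rightarrow> real" where
  "block_weight n f p = (\<Prod>i\<le>n. f (card (p ! i)))"

lemma prod_list_rows_by_length:
  fixes f :: "nat \<Rightarrow> real"
  assumes "\<And>r. r \<in> set T \<Longrightarrow> length r \<in> {1..n}"
  shows "(\<Prod>r\<leftarrow>T. f (length r)) = (\<Prod>i=1..n. f i ^ w_rows i T)"
  using assms
proof (induction T)
  case Nil
  show ?case by (simp add: w_rows_def)
next
  case (Cons r T)
  have "(\<Prod>i=1..n. f i ^ w_rows i (r # T)) =
      (\<Prod>i=1..n. (if i = length r then f i else 1) * f i ^ w_rows i T)"
    by (intro prod.cong refl) (auto simp: w_rows_def)
  also have "\<dots> = f (length r) * (\<Prod>i=1..n. f i ^ w_rows i T)"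
    using Cons.prems[of r] by (simp add: prod.distrib)
  also have "\<dots> = (\<Prod>r\<leftarrow>r # T. f (length r))"
    using Cons by simp
  finally show ?case ..
qed

text \<open>\<open>phi\<close> preserves the multiset of sizes of the nonempty blocks as row
  lengths; the remaining \<open>n + 1 - num_rows (phi p)\<close> blocks are empty and give the power
  of \<open>f 0\<close>. The weight thus depends only on \<open>phi p\<close>.\<close>

lemma block_weight_eq:
  fixes f :: "nat \<Rightarrow> real"
  assumes p: "p \<in> placements n"
  shows "block_weight n f p =
    f 0 ^ (n + 1 - num_rows (phi p)) * (\<Prod>i=1..n. f i ^ w_rows i (phi p))"
proof -
  let ?R = "arrange_rows (rows p)"
  note len = placementsD(1)[OF p]
  have prod_nonempty: "(\<Prod>r\<leftarrow>R. f (length r)) =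
      f 0 ^ (length R - length (filter (\<lambda>r. r \<noteq> []) R)) * (\<Prod>r\<leftarrow>filter (\<lambda>r. r \<noteq> []) R. f (length r))"
    for R :: tableau
  proof (induction R)
    case (Cons r R)
    then show ?case by (cases r) (simp_all add: Suc_diff_le length_filter_le)
  qed simp
  have rows_phi: "map length (phi p) = map length ?R"
    by (simp add: phi_eq map_length_sort_columns)
  have "mset ?R = mset (filter (\<lambda>r. r \<noteq> []) (rows p))" by (rule mset_arrange_rows)
  then have "length ?R = length (filter (\<lambda>r. r \<noteq> []) (rows p))"
    and "(\<Prod>r\<leftarrow>?R. f (length r)) = (\<Prod>r\<leftarrow>filter (\<lambda>r. r \<noteq> []) (rows p). f (length r))"
    unfolding prod_mset_prod_list[symmetric] mset_map by (rule mset_eq_length) (simp only: mset_arrange_rows)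
  moreover have "length (phi p) = length ?R"
    using arg_cong[OF rows_phi, of length] by simp
  moreover have "(\<Prod>r\<leftarrow>phi p. f (length r)) = (\<Prod>r\<leftarrow>?R. f (length r))"
    using arg_cong[OF rows_phi, of "map f"] by (simp add: o_def)
  moreover have "block_weight n f p = (\<Prod>r\<leftarrow>rows p. f (length r))"
    unfolding block_weight_def prod.list_conv_set_nth
    using len by (intro prod.cong) auto
  moreover have "(\<Prod>r\<leftarrow>phi p. f (length r)) = (\<Prod>i=1..n. f i ^ w_rows i (phi p))"
    using SYT_length_row[OF phi_in_SYT[OF p]] by (intro prod_list_rows_by_length) simp
  ultimately show ?thesis
    using len prod_nonempty[of "rows p"] by (simp add: num_rows_def)
qed

text \<open>Written in the form of one summand of the derivative of a product, with block
  \<open>j\<close> as the differentiated factor.\<close>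

lemma block_weight_insert_entry:
  assumes p: "p \<in> placements n" and j: "j \<le> n"
  shows "block_weight (Suc n) f (insert_entry n p j) =
    f 0 * (f (Suc (card (p ! j))) * (\<Prod>i\<in>{..n} - {j}. f (card (p ! i))))"
proof -
  note nth = nth_insert_entry[OF placementsD(1)[OF p]]
  have sub: "p ! j \<subseteq> {1..n}" using placementsD(6)[OF p j] .
  then have "finite (p ! j)" "Suc n \<notin> p ! j" using finite_subset by auto
  then have card_j: "card (insert_entry n p j ! j) = Suc (card (p ! j))"
    using j by (simp add: nth)
  have "block_weight (Suc n) f (insert_entry n p j) =
      f 0 * (\<Prod>i\<le>n. f (card (insert_entry n p j ! i)))"
    by (simp add: block_weight_def nth)
  also have "(\<Prod>i\<le>n. f (card (insert_entry n p j ! i))) =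
      f (Suc (card (p ! j))) * (\<Prod>i\<in>{..n} - {j}. f (card (insert_entry n p j ! i)))"
    using j by (simp add: prod.remove[of _ j] card_j)
  also have "(\<Prod>i\<in>{..n} - {j}. f (card (insert_entry n p j ! i))) =
      (\<Prod>i\<in>{..n} - {j}. f (card (p ! i)))"
    by (intro prod.cong refl) (auto simp: nth)
  finally show ?thesis .
qed

text \<open>The Leibniz rule: differentiating the factor of a block increases its size by one, which
  corresponds to inserting the entry \<open>n + 1\<close> into it; the new factor \<open>c\<close> is the new empty block.\<close>

lemma cD_power_eq_sum_placements:
  assumes c: "smooth_on S c" and x: "x \<in> S"
  shows "(cD c ^^ n) c x = (\<Sum>p\<in>placements n. block_weight n (\<lambda>k. (deriv ^^ k) c x) p)"
  using x
proof (induction n arbitrary: x)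
  case 0
  show ?case by (simp add: placements_0 block_weight_def)
next
  case (Suc n)
  let ?F = "\<lambda>y. \<Sum>p\<in>placements n. block_weight n (\<lambda>k. (deriv ^^ k) c y) p"
  let ?d = "\<lambda>k. (deriv ^^ k) c x"
  have d: "((deriv ^^ k) c has_field_derivative ?d (Suc k)) (at x)" for k
    using c Suc.prems by (simp add: smooth_on_def DERIV_deriv_iff_real_differentiable)
  have "(?F has_field_derivative
      (\<Sum>p\<in>placements n. \<Sum>j\<le>n. ?d (Suc (card (p ! j))) *
        (\<Prod>i\<in>{..n} - {j}. ?d (card (p ! i))))) (at x)"
    unfolding block_weight_def by (intro DERIV_sum has_field_derivative_prod d)
  then have "((cD c ^^ n) c has_field_derivative
      (\<Sum>p\<in>placements n. \<Sum>j\<le>n. ?d (Suc (card (p ! j))) *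
        (\<Prod>i\<in>{..n} - {j}. ?d (card (p ! i))))) (at x)"
    \<comment> \<open>The induction hypothesis holds throughout the open set \<open>S\<close>, so
      the two functions agree near \<open>x\<close> and share their derivative there.\<close>
    by (rule has_field_derivative_transform_within_open[of _ _ _ S])
      (use c Suc in \<open>auto simp: smooth_on_def\<close>)
  then have "(cD c ^^ Suc n) c x = c x * (\<Sum>p\<in>placements n. \<Sum>j\<le>n. ?d (Suc (card (p ! j))) *
        (\<Prod>i\<in>{..n} - {j}. ?d (card (p ! i))))"
    by (simp add: cD_def DERIV_imp_deriv)
  also have "\<dots> = (\<Sum>p\<in>placements n. \<Sum>j\<le>n. block_weight (Suc n) ?d (insert_entry n p j))"
    unfolding sum_distrib_left by (intro sum.cong refl) (simp add: block_weight_insert_entry)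
  also have "\<dots> = (\<Sum>p\<in>placements (Suc n). block_weight (Suc n) ?d p)"
    by (rule sum_placements_Suc[symmetric])
  finally show ?case .
qed

text \<open>Grouping the placements by their image under \<open>phi\<close> makes the weight
  constant on each group, so a group contributes the fiber size times the weight.\<close>

lemma cD_power_eq_sum_SYT:
  assumes n: "n \<ge> 1" and c: "smooth_on S c" and x: "x \<in> S"
  shows "(cD c ^^ n) c x = (\<Sum>T\<in>SYT n. real (card (phi_fiber n T)) * tableau_weight n c T x)"
proof -
  have "(cD c ^^ n) c x = (\<Sum>p\<in>placements n. tableau_weight n c (phi p) x)"
    unfolding cD_power_eq_sum_placements[OF c x]
    by (intro sum.cong refl) (simp add: block_weight_eq tableau_weight_def)
  also have "\<dots> = (\<Sum>T\<in>SYT n. \<Sum>p\<in>{p \<in> placements n. phi p = T}. tableau_weight n c (phi p) x)"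
    using phi_in_SYT by (intro sum.group[symmetric] finite_placements finite_SYT) auto
  also have "\<dots> = (\<Sum>T\<in>SYT n. real (card (phi_fiber n T)) * tableau_weight n c T x)"
    by (simp add: phi_fiber_def OWP_eq_placements[OF n])
  finally show ?thesis .
qed

theorem theorem4p5:
  fixes n :: nat
  assumes "n \<ge> 1"
  shows "(\<forall>T\<in>SYT n. card (phi_fiber n T) = (\<Prod>i=1..n. syt_sigma i T)) \<and>
    (\<forall>(c :: real \<Rightarrow> real) S. smooth_on S c \<longrightarrow> (\<forall>x\<in>S.
       (cD c ^^ n) c x = (\<Sum>T\<in>SYT n. real (card (phi_fiber n T)) * tableau_weight n c T x) \<and>
       (\<Sum>T\<in>SYT n. real (card (phi_fiber n T)) * tableau_weight n c T x) =
         (\<Sum>T\<in>SYT n. (\<Prod>i=1..n. real (syt_sigma i T) * (deriv ^^ i) c x ^ w_rows i T)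
            * c x ^ (n + 1 - num_rows T))))"
proof (intro conjI ballI allI impI)
  show "card (phi_fiber n T) = (\<Prod>i=1..n. syt_sigma i T)" if "T \<in> SYT n" for T
    using card_phi_fiber[OF assms that] .
  show "(cD c ^^ n) c x = (\<Sum>T\<in>SYT n. real (card (phi_fiber n T)) * tableau_weight n c T x)"
    if "smooth_on S c" "x \<in> S" for c :: "real \<Rightarrow> real" and S x
    using cD_power_eq_sum_SYT[OF assms that] .
  show "(\<Sum>T\<in>SYT n. real (card (phi_fiber n T)) * tableau_weight n c T x) =
      (\<Sum>T\<in>SYT n. (\<Prod>i=1..n. real (syt_sigma i T) * (deriv ^^ i) c x ^ w_rows i T)
         * c x ^ (n + 1 - num_rows T))" for c :: "real \<Rightarrow> real" and x
    by (intro sum.cong refl)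
      (simp add: card_phi_fiber[OF assms] tableau_weight_def prod.distrib mult_ac)
qed

end
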